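(* Let $n\ge 0$ and $0\le m\le 2^n$. If $m\le 2^n-1$, write the design $\{m\}_n$ as $1^{k_0}0^{k_1}1^{k_2}\cdots 0^{k_{l-2}}1^{k_{l-1}}$ with $l$ odd, $k_0\ge 0$, $k_i\ge1$ for $i=1,\dots,l-2$, and $k_{l-1}\ge 0$; if $m=2^n$, take $l=3$ and $(k_0,k_1,k_2)=(1,n,0)$. Then \[ [2^n:m]=[k_0,k_1,\dots,k_{l-1}]. \] In particular, if $k_{l-1}=0$ and $l\ge3$, then $[2^n:m]=[k_0,k_1,\dots,k_{l-3}]$.
   Context: Stern's diatomic integers: for integers $n\ge0$, $0\le m\le 2^n$, define $[2^0:0]=0$, $[2^0:1]=1$, $[2^{n+1}:2m]=[2^n:m]$ ($0\le m\le 2^n$), $[2^{n+1}:2m+1]=[2^n:m]+[2^n:m+1]$ ($0\le m\le 2^n-1$). For $0\le m\le 2^n-1$, $\{m\}_n$ is the binary word $d_1\cdots d_n$ of length $n$ (leading zeros allowed, empty if $n=0$) with $\sum 2^{n-i}d_i=m$; $x^k$ denotes $k$ copies of the letter $x$. Every finite binary word has a unique such run decomposition. Continuant: $[x_0]=x_0$, $[x_0,x_1]=x_0x_1+1$, and $[x_0,\dots,x_{l-1}]=[x_0,\dots,x_{l-2}]\,x_{l-1}+[x_0,\dots,x_{l-3}]$ for $l\ge 3$; for the empty sequence $[\,]=1$ (so the recursion also holds for $l=2$). *)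

theory Defs
  imports Main
begin

text \<open>\<open>stern n m\<close> is \<open>[2^n : m]\<close>. Only arguments with \<open>m \<le> 2^n\<close> are meaningful; the
  recursion stays inside that range.\<close>

fun stern :: "nat \<Rightarrow> nat \<Rightarrow> nat" where
  "stern 0 m = (if m = 0 then 0 else 1)"
| "stern (Suc n) m =
     (if even m then stern n (m div 2) else stern n (m div 2) + stern n (m div 2 + 1))"

lemma stern_Suc_even: "stern (Suc n) (2 * m) = stern n m"
  by simp

lemma stern_Suc_odd: "stern (Suc n) (2 * m + 1) = stern n m + stern n (m + 1)"
  by simp

text \<open>Words are lists of the letters \<open>0\<close> and \<open>1\<close>; the letter \<open>d\<^sub>i\<close> is \<open>d ! (i - 1)\<close>.\<close>

definition is_design :: "nat \<Rightarrow> nat \<Rightarrow> nat list \<Rightarrow> bool" where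
  "is_design n m d \<longleftrightarrow>
     length d = n \<and> set d \<subseteq> {0, 1} \<and> (\<Sum>i = 1..n. 2 ^ (n - i) * d ! (i - 1)) = m"

definition design :: "nat \<Rightarrow> nat \<Rightarrow> nat list" where
  "design n m = (THE d. is_design n m d)"

lemma design_sum_snoc:
  assumes "length d = n"
  shows "(\<Sum>i = 1..Suc n. 2 ^ (Suc n - i) * (d @ [b]) ! (i - 1)) =
    2 * (\<Sum>i = 1..n. 2 ^ (n - i) * d ! (i - 1)) + (b::nat)"
proof -
  have "(\<Sum>i = 1..n. 2 ^ (Suc n - i) * (d @ [b]) ! (i - 1)) =
    (\<Sum>i = 1..n. 2 * (2 ^ (n - i) * d ! (i - 1)))"
    by (rule sum.cong) (use assms in \<open>auto simp: nth_append Suc_diff_le\<close>)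
  then show ?thesis
    using assms by (simp add: sum_distrib_left nth_append)
qed

lemma is_design_snoc:
  "is_design (Suc n) m (d @ [b]) \<longleftrightarrow> is_design n (m div 2) d \<and> b = m mod 2"
proof -
  have "b \<in> {0, 1} \<Longrightarrow> 2 * s + b = m \<longleftrightarrow> s = m div 2 \<and> b = m mod 2" for s
    by auto
  moreover have "m mod 2 \<in> {0, 1}" by auto
  ultimately show ?thesis
    unfolding is_design_def using design_sum_snoc[of d n b] by auto
qed

lemma ex1_is_design: "m < 2 ^ n \<Longrightarrow> \<exists>!d. is_design n m d"
proof (induction n arbitrary: m)
  case 0
  then show ?case by (auto simp: is_design_def)
next
  case (Suc n)
  then have "\<exists>!d. is_design n (m div 2) d" by auto
  then obtain d where d: "is_design n (m div 2) d"
    and u: "\<And>d'. is_design n (m div 2) d' \<Longrightarrow> d' = d" by blast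
  show ?case
  proof (rule ex1I)
    show "is_design (Suc n) m (d @ [m mod 2])" using d by (simp add: is_design_snoc)
    fix e assume e: "is_design (Suc n) m e"
    then obtain e' b where "e = e' @ [b]"
      by (metis is_design_def length_Suc_conv_rev)
    with e u show "e = d @ [m mod 2]" by (auto simp: is_design_snoc)
  qed
qed

lemma is_design_design: "m < 2 ^ n \<Longrightarrow> is_design n m (design n m)"
  unfolding design_def by (rule theI') (rule ex1_is_design)

text \<open>The word \<open>1\<^bsup>k\<^sub>0\<^esup>0\<^bsup>k\<^sub>1\<^esup>1\<^bsup>k\<^sub>2\<^esup>\<dots>\<close> for \<open>ks = [k\<^sub>0, k\<^sub>1, k\<^sub>2, \<dots>]\<close>.\<close>

definition run_word :: "nat list \<Rightarrow> nat list" where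
  "run_word ks = concat (map (\<lambda>i. replicate (ks ! i) (if even i then 1 else 0)) [0..<length ks])"

definition is_run_decomposition :: "nat list \<Rightarrow> nat list \<Rightarrow> bool" where
  "is_run_decomposition w ks \<longleftrightarrow>
     odd (length ks) \<and> (\<forall>i. 1 \<le> i \<and> i + 2 \<le> length ks \<longrightarrow> ks ! i \<ge> 1) \<and> run_word ks = w"

lemma run_word_single: "run_word [a] = replicate a 1"
  by (simp add: run_word_def)

lemma run_word_Cons2: "run_word (a # b # ks) = replicate a 1 @ replicate b 0 @ run_word ks"
proof -
  have "[0..<length (a # b # ks)] = 0 # 1 # map (\<lambda>i. i + 2) [0..<length ks]"
    by (simp add: upt_conv_Cons map_Suc_upt[symmetric] del: upt_Suc)
  then show ?thesis
    unfolding run_word_def by (simp add: o_def)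
qed

lemma is_run_decomposition_single:
  "is_run_decomposition w [a] \<longleftrightarrow> w = replicate a 1"
  by (auto simp: is_run_decomposition_def run_word_single)

lemma is_run_decomposition_Cons2:
  "is_run_decomposition w (a # b # ks) \<longleftrightarrow>
     b \<ge> 1 \<and> (length ks \<ge> 2 \<longrightarrow> hd ks \<ge> 1) \<and>
     (\<exists>v. is_run_decomposition v ks \<and> w = replicate a 1 @ replicate b 0 @ v)"
proof -
  have "(\<forall>i. 1 \<le> i \<and> i + 2 \<le> length (a # b # ks) \<longrightarrow> (a # b # ks) ! i \<ge> 1) \<longleftrightarrow>
    b \<ge> 1 \<and> (length ks \<ge> 2 \<longrightarrow> hd ks \<ge> 1) \<and> (\<forall>i. 1 \<le> i \<and> i + 2 \<le> length ks \<longrightarrow> ks ! i \<ge> 1)"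
    (is "?L \<longleftrightarrow> ?R") if "odd (length ks)"
  proof
    assume L: ?L
    have "b \<ge> 1" using L[rule_format, of 1] that by (cases ks) auto
    moreover have "hd ks \<ge> 1" if "length ks \<ge> 2"
      using L[rule_format, of 2] that by (cases ks) auto
    moreover have "ks ! i \<ge> 1" if "1 \<le> i \<and> i + 2 \<le> length ks" for i
      using L[rule_format, of "i + 2"] that by auto
    ultimately show ?R by blast
  next
    assume R: ?R
    show ?L
    proof (intro allI impI)
      fix i assume i: "1 \<le> i \<and> i + 2 \<le> length (a # b # ks)"
      consider "i = 1" | "i = 2" | j where "i = j + 2" "j \<ge> 1"
        using i that(3)[of "i - 2"] by linarith
      then show "(a # b # ks) ! i \<ge> 1"
        using R i by cases (cases ks; auto)+
    qed
  qed
  then show ?thesis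
    unfolding is_run_decomposition_def run_word_Cons2 by auto
qed

lemma run_decomposition_hd:
  assumes "is_run_decomposition v ks" "length ks \<ge> 2 \<longrightarrow> hd ks \<ge> 1" "v \<noteq> []"
  shows "hd v = 1"
proof -
  consider a where "ks = [a]" | a b ks' where "ks = a # b # ks'"
    using assms(1) by (cases ks; cases "tl ks") (auto simp: is_run_decomposition_def)
  then show ?thesis
    using assms by cases (auto simp: is_run_decomposition_single is_run_decomposition_Cons2 hd_append hd_replicate)
qed

lemma replicate_append_cancel:
  assumes "replicate a x @ u = replicate b x @ v" "u = [] \<or> hd u \<noteq> x" "v = [] \<or> hd v \<noteq> x"
  shows "a = b \<and> u = v"
  using assms
proof (induction a arbitrary: b)
  case 0
  then show ?case by (cases b) auto
next
  case (Suc a)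
  then show ?case by (cases b) auto
qed

lemma run_decomposition_unique:
  assumes "is_run_decomposition w ks" "is_run_decomposition w ks'"
  shows "ks = ks'"
  using assms
proof (induction "length ks" arbitrary: ks ks' w rule: less_induct)
  case less
  have shape: "(\<exists>a. xs = [a]) \<or> (\<exists>a b ys. xs = a # b # ys)"
    if "is_run_decomposition w xs" for xs
    using that by (cases xs; cases "tl xs") (auto simp: is_run_decomposition_def)
  from shape[OF less.prems(1)] shape[OF less.prems(2)] 
  consider a a' where "ks = [a]" "ks' = [a']" 
    | a c d ys where "ks = [a]" "ks' = c # d # ys"
    | a c d ys where "ks' = [a]" "ks = c # d # ys"
    | a b xs c d ys where "ks = a # b # xs" "ks' = c # d # ys"
    by blast
  then show ?case
  proof cases
    case 1
    then show ?thesis using less.prems by (auto simp: is_run_decomposition_single)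
  next
    case (2 a c d ys)
    then have w1: "w = replicate a 1" and w2: "\<exists>v. w = replicate c 1 @ replicate d 0 @ v \<and> d \<ge> 1"
      using less.prems by (metis is_run_decomposition_single, metis is_run_decomposition_Cons2)
    have "set w \<subseteq> {1}" using w1 by auto
    moreover have "0 \<in> set w" using w2 by auto
    ultimately show ?thesis by auto
  next
    case (3 a c d ys)
    then have w1: "w = replicate a 1" and w2: "\<exists>v. w = replicate c 1 @ replicate d 0 @ v \<and> d \<ge> 1"
      using less.prems by (metis is_run_decomposition_single, metis is_run_decomposition_Cons2)
    have "set w \<subseteq> {1}" using w1 by auto
    moreover have "0 \<in> set w" using w2 by auto
    ultimately show ?thesis by auto
  next
    case 4
    obtain v where v: "is_run_decomposition v xs" "w = replicate a 1 @ replicate b 0 @ v"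
      "b \<ge> 1" "length xs \<ge> 2 \<longrightarrow> hd xs \<ge> 1"
      using less.prems(1) 4 by (auto simp: is_run_decomposition_Cons2)
    obtain u where u: "is_run_decomposition u ys" "w = replicate c 1 @ replicate d 0 @ u"
      "d \<ge> 1" "length ys \<ge> 2 \<longrightarrow> hd ys \<ge> 1"
      using less.prems(2) 4 by (auto simp: is_run_decomposition_Cons2)
    have "a = c \<and> replicate b 0 @ v = replicate d 0 @ u"
      by (rule replicate_append_cancel[where x = 1]) (use u v in \<open>auto simp: hd_append\<close>)
    moreover from this have "b = d \<and> v = u"
      using run_decomposition_hd[OF v(1,4)] run_decomposition_hd[OF u(1,4)]
      by (intro replicate_append_cancel[where x = 0]) force+
    ultimately show ?thesis
      using less.hyps[of xs v ys] 4 u(1) v(1) by auto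
  qed
qed

lemma run_decomposition_exists:
  "set w \<subseteq> {0, 1} \<Longrightarrow> \<exists>ks. is_run_decomposition w ks"
proof (induction w)
  case Nil
  then show ?case by (metis is_run_decomposition_single replicate_0)
next
  case (Cons x w)
  then obtain ks where ks: "is_run_decomposition w ks" by auto
  then have shape: "(\<exists>a. ks = [a]) \<or> (\<exists>a b ys. ks = a # b # ys)"
    by (cases ks; cases "tl ks") (auto simp: is_run_decomposition_def)
  show ?case
  proof (cases "x = 1")
    case True
    from shape consider a where "ks = [a]" | a b ys where "ks = a # b # ys" by blast
    then show ?thesis
    proof cases
      case (1 a)
      then have "is_run_decomposition (x # w) [Suc a]"
        using ks True by (simp add: is_run_decomposition_single)
      then show ?thesis by blast
    next
      case (2 a b ys)
      then have "is_run_decomposition (x # w) (Suc a # b # ys)"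
        using ks True by (auto simp: is_run_decomposition_Cons2)
      then show ?thesis by blast
    qed
  next
    case False
    then have x: "x = 0" using Cons.prems by simp
    show ?thesis
    proof (cases "length ks \<ge> 2 \<and> hd ks = 0")
      case True
      then obtain b ys where "ks = 0 # b # ys" using shape by auto
      then have "is_run_decomposition (x # w) (0 # Suc b # ys)"
        using ks x by (auto simp: is_run_decomposition_Cons2)
      then show ?thesis by blast
    next
      case False
      then have "is_run_decomposition (x # w) (0 # 1 # ks)"
        using ks x by (auto simp: is_run_decomposition_Cons2)
      then show ?thesis by blast
    qed
  qed
qed

lemma ex1_run_decomposition: "set w \<subseteq> {0, 1} \<Longrightarrow> \<exists>!ks. is_run_decomposition w ks"
  using run_decomposition_exists run_decomposition_unique by blast

text \<open>The continuant recursion peels off the last entries, hence the reversal.\<close>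

fun continuant_rev :: "nat list \<Rightarrow> nat" where
  "continuant_rev [] = 1"
| "continuant_rev [x] = x"
| "continuant_rev (x # y # zs) = continuant_rev (y # zs) * x + continuant_rev zs"

definition continuant :: "nat list \<Rightarrow> nat" where
  "continuant xs = continuant_rev (rev xs)"

lemma continuant_Nil: "continuant [] = 1"
  by (simp add: continuant_def)

lemma continuant_single: "continuant [x] = x"
  by (simp add: continuant_def)

lemma continuant_snoc2:
  "continuant (xs @ [y, x]) = continuant (xs @ [y]) * x + continuant xs"
  by (simp add: continuant_def)

end

theory Submission
  imports Defs
begin

text \<open>Reading the design of \<open>m\<close> from left to right, the pair \<open>([2^n : m], [2^n : m + 1])\<close> is
  updated by \<open>(a, b) \<mapsto> (a, a + b)\<close> on the letter \<open>0\<close> and by \<open>(a, b) \<mapsto> (a + b, b)\<close> on the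
  letter \<open>1\<close>. A whole run of length \<open>k\<close> therefore adds \<open>k\<close> times one entry to the other, which is
  the continuant recursion: after the runs \<open>k\<^sub>0, \<dots>, k\<^sub>j\<close> the two entries are the continuants
  of \<open>k\<^sub>0, \<dots>, k\<^sub>j\<close> and of \<open>k\<^sub>0, \<dots>, k\<^bsub>j-1\<^esub>\<close>.\<close>

definition stern_step :: "nat \<Rightarrow> nat \<times> nat \<Rightarrow> nat \<times> nat" where
  "stern_step x = (\<lambda>(a, b). if x = 0 then (a, a + b) else (a + b, b))"

text \<open>The last letter is \<open>m mod 2\<close>, the prefix is the design of
  \<open>m div 2\<close>.\<close>

lemma fold_stern_step_design:
  "is_design n m d \<Longrightarrow> fold stern_step d (0, 1) = (stern n m, stern n (m + 1))"
proof (induction n arbitrary: m d)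
  case 0
  then show ?case by (auto simp: is_design_def)
next
  case (Suc n)
  then obtain e b where d: "d = e @ [b]"
    by (metis is_design_def length_Suc_conv_rev)
  with Suc.prems have e: "is_design n (m div 2) e" and b: "b = m mod 2"
    by (simp_all add: is_design_snoc)
  from Suc.IH[OF e] b d show ?case
    by (auto simp: stern_step_def mod2_eq_if)
qed

lemma fold_stern_step_replicate:
  "fold stern_step (replicate k x) (a, b) = (if x = 0 then (a, a * k + b) else (a + b * k, b))"
  by (induction k arbitrary: a b) (auto simp: stern_step_def)

lemma run_word_snoc:
  "run_word (ks @ [k]) = run_word ks @ replicate k (if even (length ks) then 1 else 0)"
  unfolding run_word_def
  by (auto simp: nth_append intro!: arg_cong[where f = concat])

text \<open>The parity of \<open>length ks\<close> fixes the letter of the last run, hence which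
  entry that run changes.\<close>

lemma fold_stern_step_run_word:
  "fold stern_step (run_word (ks @ [k])) (0, 1) =
     (if even (length ks) then (continuant (ks @ [k]), continuant ks)
      else (continuant ks, continuant (ks @ [k])))"
proof (induction ks arbitrary: k rule: rev_induct)
  case Nil
  show ?case
    using run_word_single[of k] fold_stern_step_replicate[of k 1 0 1]
    by (simp add: continuant_Nil continuant_single)
next
  case (snoc y ks)
  have "fold stern_step (run_word ((ks @ [y]) @ [k])) (0, 1) =
    fold stern_step (replicate k (if even (length ks) then 0 else 1))
      (fold stern_step (run_word (ks @ [y])) (0, 1))"
    by (subst run_word_snoc) (simp del: fold_replicate)
  then show ?case
    using snoc.IH[of y] by (simp add: fold_stern_step_replicate continuant_snoc2 del: fold_replicate)
qed

lemma stern_eq_continuant: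
  assumes "is_design n m (run_word ks)" "odd (length ks)"
  shows "stern n m = continuant ks"
proof -
  obtain xs k where "ks = xs @ [k]"
    using assms(2) by (cases ks rule: rev_cases) auto
  \<comment> \<open>Here \<open>xs\<close> has even length, so the first entry is the continuant of
    all of \<open>ks\<close>.\<close>
  then show ?thesis
    using assms fold_stern_step_design[OF assms(1)] fold_stern_step_run_word[of xs k] by simp
qed

lemma stern_power_two: "stern n (2 ^ n) = 1"
  by (induction n) auto

text \<open>A last entry 0 kills the product in the recursion.\<close>

lemma continuant_last_zero:
  assumes "length ks \<ge> 2" "ks ! (length ks - 1) = 0"
  shows "continuant ks = continuant (take (length ks - 2) ks)"
proof -
  obtain xs y z where "ks = xs @ [y, z]"
    using assms(1) by (cases ks rule: rev_cases; cases "butlast ks" rule: rev_cases) auto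
  then show ?thesis
    using assms(2) by (simp add: continuant_snoc2 nth_append)
qed

theorem theorem4p3:
  fixes n m :: nat and ks :: "nat list"
  assumes "m \<le> 2 ^ n"
    and "m \<le> 2 ^ n - 1 \<Longrightarrow> is_run_decomposition (design n m) ks"
    and "m = 2 ^ n \<Longrightarrow> ks = [1, n, 0]"
  shows "stern n m = continuant ks \<and>
    (length ks \<ge> 3 \<and> ks ! (length ks - 1) = 0 \<longrightarrow>
      stern n m = continuant (take (length ks - 2) ks))"
proof -
  have "stern n m = continuant ks"
  proof (cases "m = 2 ^ n")
    case True
    \<comment> \<open>For every \<open>n\<close>, \<open>[1, n, 0]\<close> has the continuant of
      \<open>[1]\<close>.\<close>
    then show ?thesis
      using assms(3) stern_power_two[of n] by (simp add: continuant_def)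
  next
    case False
    with assms(1) have "m < 2 ^ n" by simp
    then have "is_run_decomposition (design n m) ks" "is_design n m (design n m)"
      using assms(2) is_design_design by auto
    then show ?thesis
      by (auto simp: is_run_decomposition_def intro: stern_eq_continuant)
  qed
  then show ?thesis
    using continuant_last_zero[of ks] by auto
qed

end
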